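(* Consider the system $\partial_t q + J^x(q)\,\partial_x q + J^y(q)\,\partial_y q = 0$ for $q\colon [0,T)\times\mathbb R^2\to\mathbb R^m$, with initial data $q(0,\mathbf x)=q_0(\mathbf x)$, $\mathbf x=(x,y)\in\mathbb R^2$. Suppose that $J^x = v^x\,I$ and $J^y = v^y\,I$, where $I$ is the $m\times m$ identity matrix and $v^x=v^x(q)$, $v^y=v^y(q)$ are smooth scalar functions of $q$, and suppose that the solution $q$ is smooth (on $[0,T)\times\mathbb R^2$, up to $t=0$). Then for every $\mathbf x\in\mathbb R^2$, as $t\to0^+$, $$ q(t,\mathbf x) = q_0\Big(\mathbf x - \mathbf v_0\big(\mathbf x - \mathbf v_0(\mathbf x)\,t\big)\,t\Big) + \mathcal O(t^3). $$
   Context: Here $\mathbf v_0(\mathbf x) = (v^x(0,\mathbf x), v^y(0,\mathbf x))$ denotes the initial velocity field, i.e. $v^x(0,\mathbf x)=v^x(q_0(\mathbf x))$ and $v^y(0,\mathbf x)=v^y(q_0(\mathbf x))$. *)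

theory Defs
  imports "HOL-Analysis.Analysis" "HOL-Library.Landau_Symbols"
begin

text \<open>
  \<open>Ck_on k S f\<close>: all iterated directional derivatives of \<open>f\<close> up to order \<open>k\<close> exist and are
  continuous on \<open>S\<close>. Derivatives are taken within \<open>S\<close>, so that at boundary points belonging to
  \<open>S\<close> they are one-sided. The derivative \<open>D\<close> is unique if \<open>S\<close> is convex with nonempty interior,
  as is the case for \<open>S = {0..<T} \<times> UNIV\<close> with \<open>T > 0\<close> and for \<open>S = UNIV\<close>.
\<close>

primrec Ck_on ::
  "nat \<Rightarrow> 'a::euclidean_space set \<Rightarrow> ('a \<Rightarrow> 'b::real_normed_vector) \<Rightarrow> bool" where
  "Ck_on 0 S f \<longleftrightarrow> continuous_on S f"
| "Ck_on (Suc k) S f \<longleftrightarrow>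
     (\<exists>D. (\<forall>x\<in>S. (f has_derivative D x) (at x within S)) \<and>
          (\<forall>v. Ck_on k S (\<lambda>x. D x v)))"

definition smooth_on ::
  "'a::euclidean_space set \<Rightarrow> ('a \<Rightarrow> 'b::real_normed_vector) \<Rightarrow> bool" where
  "smooth_on S f \<longleftrightarrow> (\<forall>k. Ck_on k S f)"

definition initial_velocity ::
  "('q \<Rightarrow> real) \<Rightarrow> ('q \<Rightarrow> real) \<Rightarrow> (real \<times> real \<Rightarrow> 'q) \<Rightarrow> real \<times> real \<Rightarrow> real \<times> real" where
  "initial_velocity vx vy q0 \<xi> = (vx (q0 \<xi>), vy (q0 \<xi>))"

end

theory Submission
  imports Defs
begin

text \<open>
  The velocity is constant along characteristics, which are therefore straight lines, and this gives
  the exact implicit formula \<open>q(t, x) = q0 (x - t w)\<close> with \<open>w = v (q(t, x))\<close> for small \<open>t\<close>. No flow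
  has to be constructed: on the segment \<open>s \<mapsto> (s, x - (t - s) w)\<close> the deviation
  \<open>e(s) = q(s, x - (t - s) w) - q(t, x)\<close> vanishes at \<open>s = t\<close> and satisfies \<open>|e'| \<le> C |e|\<close>, hence
  vanishes identically. Then \<open>w\<close> is the fixed point of \<open>w \<mapsto> v0 (x - t w)\<close>, which has Lipschitz
  constant \<open>O(t)\<close>; so two steps of the iteration started at \<open>0\<close> reach \<open>w\<close> up to \<open>O(t^2)\<close>,
  and inserting the result into \<open>q0 (x - t w)\<close> gains a further factor \<open>t\<close>.
\<close>

section \<open>Derivative bounds and Lipschitz constants on compact sets\<close>

text \<open>\<open>Ck_on\<close> supplies continuity of \<open>D x v\<close> for each fixed
  direction \<open>v\<close>, not continuity in operator norm. In finite dimension this is enough: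
  by linearity the operator norm is at most the sum of the norms of the images of the basis vectors,
  which is continuous on \<open>K\<close>.\<close>

lemma onorm_bounded_on_compact:
  fixes D :: "'a::topological_space \<Rightarrow> 'b::euclidean_space \<Rightarrow> 'c::real_normed_vector"
  assumes "compact K" and lin: "\<And>x. x \<in> K \<Longrightarrow> linear (D x)"
    and cont: "\<And>v. continuous_on K (\<lambda>x. D x v)"
  obtains B where "0 \<le> B" "\<And>x. x \<in> K \<Longrightarrow> onorm (D x) \<le> B"
proof -
  have "continuous_on K (\<lambda>x. \<Sum>b\<in>Basis. norm (D x b))"
    by (intro continuous_intros cont)
  then have "bounded ((\<lambda>x. \<Sum>b\<in>Basis. norm (D x b)) ` K)"
    using \<open>compact K\<close> by (intro compact_imp_bounded compact_continuous_image)
  then obtain B where B: "0 < B" "\<And>x. x \<in> K \<Longrightarrow> \<bar>\<Sum>b\<in>Basis. norm (D x b)\<bar> \<le> B"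
    by (auto simp: bounded_pos)
  have "onorm (D x) \<le> B" if "x \<in> K" for x
  proof (rule onorm_bound)
    fix v
    have "D x v = (\<Sum>b\<in>Basis. (v \<bullet> b) *\<^sub>R D x b)"
      using linear_sum[OF lin[OF that], of "\<lambda>b. (v \<bullet> b) *\<^sub>R b" Basis]
        linear_scale[OF lin[OF that]] by (simp add: euclidean_representation)
    also have "norm \<dots> \<le> (\<Sum>b\<in>Basis. norm v * norm (D x b))"
      by (intro sum_norm_le) (auto intro!: mult_right_mono Basis_le_norm)
    also have "\<dots> = norm v * (\<Sum>b\<in>Basis. norm (D x b))"
      by (simp add: sum_distrib_left)
    also have "\<dots> \<le> norm v * B"
      using B(2)[OF that] by (intro mult_left_mono) auto
    finally show "norm (D x v) \<le> B * norm v" by (simp add: mult.commute)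
  qed (use B in auto)
  then show thesis using B that[of B] by auto
qed

text \<open>Mean value inequality on a convex set. Keeping \<open>K\<close> apart from
  \<open>S\<close> admits thin sets such as the initial slice
  \<open>{0} \<times> cball \<xi> 1\<close>: the derivative is controlled within \<open>S\<close>
  and merely restricted to \<open>K\<close>.\<close>

lemma C1_imp_lipschitz_on_compact_convex:
  fixes f :: "'a::euclidean_space \<Rightarrow> 'b::real_normed_vector"
  assumes "compact K" "convex K" "K \<subseteq> S"
    and deriv: "\<And>x. x \<in> S \<Longrightarrow> (f has_derivative D x) (at x within S)"
    and cont: "\<And>v. continuous_on S (\<lambda>x. D x v)"
  obtains L where "L-lipschitz_on K f"
proof -
  obtain B where "0 \<le> B" "\<And>x. x \<in> K \<Longrightarrow> onorm (D x) \<le> B"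
  proof (rule onorm_bounded_on_compact[OF \<open>compact K\<close>, of D])
    show "linear (D x)" if "x \<in> K" for x
      using deriv[of x] that \<open>K \<subseteq> S\<close> has_derivative_linear by blast
    show "continuous_on K (\<lambda>x. D x v)" for v
      using cont \<open>K \<subseteq> S\<close> continuous_on_subset by blast
  qed blast
  then have "B-lipschitz_on K f"
    using \<open>convex K\<close> \<open>K \<subseteq> S\<close>
    by (intro bounded_derivative_imp_lipschitz[where f' = D])
      (auto intro: has_derivative_subset[OF deriv])
  then show thesis by (rule that)
qed

section \<open>Uniqueness along straight characteristics and the implicit formula\<close>

text \<open>A short-time substitute for Gronwall's inequality. At a point \<open>m\<close> where
  \<open>norm (e m)\<close> is maximal, the mean value inequality between \<open>m\<close> and
  \<open>t\<close> gives \<open>norm (e m) \<le> C * t * norm (e m)\<close>, and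
  \<open>C * t < 1\<close> forces the maximum to be zero.\<close>

lemma zero_of_derivative_le_norm:
  fixes e :: "real \<Rightarrow> 'a::real_normed_vector"
  assumes "0 \<le> t" "0 \<le> C" "C * t < 1" and "e t = 0"
    and deriv: "\<And>s. s \<in> {0..t} \<Longrightarrow> (e has_vector_derivative e' s) (at s within {0..t})"
    and bound: "\<And>s. s \<in> {0..t} \<Longrightarrow> norm (e' s) \<le> C * norm (e s)"
    and "s \<in> {0..t}"
  shows "e s = 0"
proof -
  have "continuous_on {0..t} e"
    using deriv has_vector_derivative_continuous continuous_on_eq_continuous_within by blast
  then have "continuous_on {0..t} (\<lambda>s. norm (e s))"
    by (intro continuous_intros)
  from continuous_attains_sup[OF _ _ this] obtain m
    where m: "m \<in> {0..t}" "\<And>s. s \<in> {0..t} \<Longrightarrow> norm (e s) \<le> norm (e m)"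
    using \<open>0 \<le> t\<close> by auto
  have "norm (e m - e t) \<le> C * norm (e m) * norm (m - t)"
  proof (rule differentiable_bound[where S = "{0..t}"])
    show "(e has_derivative (\<lambda>h. h *\<^sub>R e' s)) (at s within {0..t})" if "s \<in> {0..t}" for s
      using deriv[OF that] by (simp add: has_vector_derivative_def)
    show "onorm (\<lambda>h. h *\<^sub>R e' s) \<le> C * norm (e m)" if "s \<in> {0..t}" for s
    proof (rule onorm_bound)
      have "norm (e' s) \<le> C * norm (e m)"
        using bound[OF that] mult_left_mono[OF m(2)[OF that] \<open>0 \<le> C\<close>] by linarith
      then show "norm (h *\<^sub>R e' s) \<le> C * norm (e m) * norm h" for h
        using mult_left_mono[of "norm (e' s)" "C * norm (e m)" "norm h"]
        by (simp add: mult_ac)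
    qed (use \<open>0 \<le> C\<close> in auto)
  qed (use m \<open>0 \<le> t\<close> in auto)
  also have "\<dots> \<le> C * norm (e m) * t"
    using m(1) \<open>0 \<le> C\<close> by (intro mult_left_mono) auto
  finally have "norm (e m) * (1 - C * t) \<le> 0"
    using \<open>e t = 0\<close> by (simp add: algebra_simps)
  then have "norm (e m) \<le> 0"
    using \<open>C * t < 1\<close> by (simp add: mult_le_0_iff)
  then show ?thesis using m(2)[OF \<open>s \<in> {0..t}\<close>] by simp
qed

lemma transport_implicit_solution:
  fixes F :: "real \<times> 'b::euclidean_space \<Rightarrow> 'c::euclidean_space"
  assumes "0 < T"
    and deriv: "\<And>z. z \<in> {0..<T} \<times> UNIV \<Longrightarrow> (F has_derivative D z) (at z within {0..<T} \<times> UNIV)"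
    and cont: "\<And>u. continuous_on ({0..<T} \<times> UNIV) (\<lambda>z. D z u)"
    and transport: "\<And>z. z \<in> {0..<T} \<times> UNIV \<Longrightarrow> D z (1, v (F z)) = 0"
    and lip: "\<And>r. \<exists>L. L-lipschitz_on (cball 0 r) v"
  shows "\<forall>\<^sub>F t in at_right 0. F (t, \<xi>) = F (0, \<xi> - t *\<^sub>R v (F (t, \<xi>)))"
proof -
  let ?S = "{0..<T} \<times> (UNIV :: 'b set)"
  \<comment> \<open>Half the lifespan keeps the closed interval \<open>{0..\<tau>}\<close> inside
    \<open>{0..<T}\<close>, which makes compactness available.\<close>
  define \<tau> where "\<tau> = T / 2"
  have \<tau>: "0 < \<tau>" "\<tau> < T" using \<open>0 < T\<close> by (auto simp: \<tau>_def)
  have contF: "continuous_on ?S F"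
    using deriv by (auto simp: continuous_on_eq_continuous_within intro: has_derivative_continuous)
  have contv: "continuous_on UNIV v"
  proof -
    have "isCont v x" for x
    proof -
      \<comment> \<open>The radius \<open>norm x + 1\<close> puts \<open>x\<close> in the interior
        of the ball.\<close>
      obtain L where "L-lipschitz_on (cball 0 (norm x + 1)) v" using lip by blast
      then have "continuous_on (cball 0 (norm x + 1)) v" by (rule lipschitz_on_continuous_on)
      then show ?thesis
        by (rule continuous_on_interior) auto
    qed
    then show ?thesis by (simp add: continuous_at_imp_continuous_on)
  qed
  have "continuous_on {0..\<tau>} (\<lambda>t. v (F (t, \<xi>)))"
    using \<tau> by (intro continuous_on_compose2[OF contv] continuous_on_compose2[OF contF]
        continuous_intros) auto
  then have "bounded ((\<lambda>t. v (F (t, \<xi>))) ` {0..\<tau>})"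
    by (intro compact_imp_bounded compact_continuous_image) auto
  then obtain B where B: "0 < B" "\<And>t. t \<in> {0..\<tau>} \<Longrightarrow> norm (v (F (t, \<xi>))) \<le> B"
    by (auto simp: bounded_pos)
  \<comment> \<open>For every \<open>t < \<tau>\<close> the backward segment from
    \<open>(t, \<xi>)\<close> has speed at most \<open>B\<close>, so it stays in \<open>K\<close>.
    As \<open>K\<close> does not depend on \<open>t\<close>, neither do the constants derived from
    it.\<close>
  define K where "K = {0..\<tau>} \<times> cball \<xi> (\<tau> * B)"
  have K: "compact K" "K \<subseteq> ?S"
    using \<tau> B by (auto simp: K_def compact_Times)
  obtain C1 where C1: "0 \<le> C1" "\<And>z. z \<in> K \<Longrightarrow> onorm (D z) \<le> C1"
  proof (rule onorm_bounded_on_compact[OF \<open>compact K\<close>, of D])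
    show "linear (D z)" if "z \<in> K" for z
      using deriv[of z] that \<open>K \<subseteq> ?S\<close> has_derivative_linear by blast
    show "continuous_on K (\<lambda>z. D z u)" for u
      using cont \<open>K \<subseteq> ?S\<close> continuous_on_subset by blast
  qed blast
  \<comment> \<open>\<open>v\<close> is Lipschitz on balls, so a ball containing all values of
    \<open>F\<close> on \<open>K\<close> is fixed first.\<close>
  have "bounded (F ` K)"
    using K contF by (intro compact_imp_bounded compact_continuous_image)
      (auto intro: continuous_on_subset)
  then obtain R where R: "\<And>z. z \<in> K \<Longrightarrow> norm (F z) \<le> R"
    by (auto simp: bounded_iff)
  obtain L where L: "L-lipschitz_on (cball 0 R) v" using lip by blast
  then have "0 \<le> L" by (rule lipschitz_on_nonneg)
  define C where "C = C1 * L"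
  have "0 \<le> C" using C1(1) \<open>0 \<le> L\<close> by (simp add: C_def)
  have main: "F (t, \<xi>) = F (0, \<xi> - t *\<^sub>R v (F (t, \<xi>)))"
    if t: "0 < t" "t < \<tau>" "C * t < 1" for t
  proof -
    \<comment> \<open>The velocity is frozen at the end point, so \<open>p\<close> is an explicit
      line that reaches \<open>(t, \<xi>)\<close> at \<open>s = t\<close>.\<close>
    define w where "w = v (F (t, \<xi>))"
    define p where "p = (\<lambda>s. (s, \<xi> - (t - s) *\<^sub>R w))"
    define e where "e = (\<lambda>s. F (p s) - F (t, \<xi>))"
    have pK: "p s \<in> K" if "s \<in> {0..t}" for s
    proof -
      have "norm ((t - s) *\<^sub>R w) \<le> \<tau> * B"
        using that t B(2)[of t] B(1) by (auto simp: w_def intro!: mult_mono)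
      then show ?thesis using that t by (auto simp: p_def K_def dist_norm)
    qed
    have tK: "(t, \<xi>) \<in> K" using pK[of t] t by (simp add: p_def)
    have dp: "(p has_vector_derivative (1, w)) (at s within {0..t})" for s
      unfolding p_def by (auto intro!: derivative_eq_intros)
    have de: "(e has_vector_derivative D (p s) (1, w)) (at s within {0..t})"
      if "s \<in> {0..t}" for s
    proof -
      have "(F has_derivative D (p s)) (at (p s) within p ` {0..t})"
        using pK K(2) that by (intro has_derivative_subset[OF deriv]) blast+
      from vector_derivative_diff_chain_within[OF dp this]
      have "(F \<circ> p has_vector_derivative D (p s) (1, w)) (at s within {0..t})" .
      then show ?thesis
        unfolding e_def o_def by (auto intro!: derivative_eq_intros)
    qed
    have bd: "norm (D (p s) (1, w)) \<le> C * norm (e s)" if s: "s \<in> {0..t}" for s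
    proof -
      have z: "p s \<in> K" "p s \<in> ?S" using pK[OF s] K(2) by auto
      have bl: "bounded_linear (D (p s))"
        using deriv[OF z(2)] by (rule has_derivative_bounded_linear)
      \<comment> \<open>By the transport equation the subtracted vector is mapped to zero. What
        remains is the velocity mismatch \<open>(0, w - v (F (p s)))\<close>, which the Lipschitz
        bound on \<open>v\<close> compares with \<open>e s\<close>.\<close>
      have "D (p s) (1, w) = D (p s) ((1, w) - (1, v (F (p s))))"
        using transport[OF z(2)] linear_diff[OF bounded_linear.linear[OF bl], of "(1, w)"]
        by (simp del: diff_Pair)
      also have "norm \<dots> \<le> onorm (D (p s)) * norm ((1, w) - (1 :: real, v (F (p s))))"
        by (rule onorm[OF bl])
      also have "\<dots> \<le> C1 * norm (w - v (F (p s)))"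
        using C1(2)[OF z(1)] by (intro mult_mono) (auto simp: norm_Pair C1(1))
      also have "norm (w - v (F (p s))) \<le> L * norm (e s)"
        using lipschitz_onD[OF L, of "F (t, \<xi>)" "F (p s)"] R[OF tK] R[OF z(1)]
        by (simp add: w_def e_def dist_norm norm_minus_commute)
      finally show ?thesis using C1(1) by (simp add: C_def mult_left_mono mult.assoc)
    qed
    have "e 0 = 0"
    proof (rule zero_of_derivative_le_norm[OF _ \<open>0 \<le> C\<close> \<open>C * t < 1\<close> _ de bd])
      show "e t = 0" by (simp add: e_def p_def)
    qed (use t in auto)
    then show ?thesis by (simp add: e_def p_def w_def)
  qed
  have "((\<lambda>t. C * t) \<longlongrightarrow> C * 0) (at_right 0)" by (intro tendsto_intros)
  then have "\<forall>\<^sub>F t in at_right 0. C * t < 1"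
    by (rule order_tendstoD) simp
  moreover have "\<forall>\<^sub>F t in at_right 0. t \<in> {0<..<\<tau>}"
    using \<tau> by (intro eventually_at_right_real)
  ultimately show ?thesis
    by eventually_elim (rule main, auto)
qed

section \<open>Third-order accuracy of the two-step iteration\<close>

text \<open>The differential equation enters only through the implicit formula; the rest is a
  contraction estimate. The limit \<open>vu\<close> ensures that the foot point
  \<open>\<xi> - t *\<^sub>R v (u t)\<close> eventually lies in the unit ball on which the Lipschitz
  constants hold.\<close>

lemma implicit_solution_expansion:
  fixes q0 :: "'b::real_normed_vector \<Rightarrow> 'c::real_normed_vector"
  assumes implicit: "\<forall>\<^sub>F t in at_right 0. u t = q0 (\<xi> - t *\<^sub>R v (u t))"
    and vu: "((\<lambda>t. v (u t)) \<longlongrightarrow> a) (at_right 0)"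
    and q0: "L0-lipschitz_on (cball \<xi> 1) q0"
    and v0: "L1-lipschitz_on (cball \<xi> 1) (\<lambda>x. v (q0 x))"
  shows "(\<lambda>t. norm (u t - q0 (\<xi> - t *\<^sub>R v (q0 (\<xi> - t *\<^sub>R v (q0 \<xi>))))))
          \<in> O[at_right 0](\<lambda>t. t ^ 3)"
proof -
  define v\<^sub>0 where "v\<^sub>0 = (\<lambda>x. v (q0 x))"
  \<comment> \<open>A bound for the initial velocity on the unit ball: its value at the centre plus
    the Lipschitz constant times the radius 1.\<close>
  define M where "M = norm (v\<^sub>0 \<xi>) + L1"
  have nonneg: "0 \<le> L0" "0 \<le> L1" using q0 v0 by (auto dest: lipschitz_on_nonneg)
  have lip0: "norm (q0 x - q0 y) \<le> L0 * norm (x - y)" if "x \<in> cball \<xi> 1" "y \<in> cball \<xi> 1" for x y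
    using lipschitz_onD[OF q0 that] by (simp add: dist_norm)
  have lip1: "norm (v\<^sub>0 x - v\<^sub>0 y) \<le> L1 * norm (x - y)" if "x \<in> cball \<xi> 1" "y \<in> cball \<xi> 1" for x y
    using lipschitz_onD[OF v0 that] by (simp add: dist_norm v\<^sub>0_def)
  have M: "norm (v\<^sub>0 x) \<le> M" if "x \<in> cball \<xi> 1" for x
  proof -
    have "norm (v\<^sub>0 x - v\<^sub>0 \<xi>) \<le> L1 * norm (x - \<xi>)" using that by (intro lip1) auto
    also have "\<dots> \<le> L1"
      using that nonneg mult_left_mono[of "norm (x - \<xi>)" 1 L1]
      by (simp add: dist_norm norm_minus_commute)
    finally show ?thesis using norm_triangle_sub[of "v\<^sub>0 x" "v\<^sub>0 \<xi>"] by (simp add: M_def)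
  qed
  have "((\<lambda>t. norm (t *\<^sub>R v (u t))) \<longlongrightarrow> norm (0 *\<^sub>R a)) (at_right 0)"
    by (intro tendsto_intros vu)
  then have small1: "\<forall>\<^sub>F t in at_right 0. norm (t *\<^sub>R v (u t)) < 1"
    by (rule order_tendstoD) simp
  \<comment> \<open>This keeps the foot points of the iterates in the unit ball, see
    \<open>in_ball\<close>.\<close>
  have "((\<lambda>t. t * M) \<longlongrightarrow> 0 * M) (at_right 0)"
    by (intro tendsto_intros)
  then have small2: "\<forall>\<^sub>F t in at_right 0. t * M < 1"
    by (rule order_tendstoD) simp
  have "\<forall>\<^sub>F t in at_right (0::real). 0 < t" by (rule eventually_at_right_less)
  with implicit small1 small2
  have "\<forall>\<^sub>F t in at_right 0.
          norm (u t - q0 (\<xi> - t *\<^sub>R v\<^sub>0 (\<xi> - t *\<^sub>R v\<^sub>0 \<xi>))) \<le> L0 * L1\<^sup>2 * M * t ^ 3"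
  proof eventually_elim
    case (elim t)
    define w where "w = v (u t)"
    \<comment> \<open>Applying \<open>v\<close> to the implicit formula gives the fixed point
      equation for \<open>w\<close>.\<close>
    have w: "w = v\<^sub>0 (\<xi> - t *\<^sub>R w)" using elim(1) by (simp add: w_def v\<^sub>0_def)
    have in_ball: "\<xi> - t *\<^sub>R v\<^sub>0 x \<in> cball \<xi> 1" if "x \<in> cball \<xi> 1" for x
    proof -
      have "t * norm (v\<^sub>0 x) \<le> t * M"
        using M[OF that] elim by (intro mult_left_mono) auto
      then have "t * norm (v\<^sub>0 x) \<le> 1" using elim by linarith
      then show ?thesis using elim by (simp add: dist_norm)
    qed
    have w_ball: "\<xi> - t *\<^sub>R w \<in> cball \<xi> 1" using elim by (simp add: dist_norm w_def)
    \<comment> \<open>One step of the iteration from an arbitrary \<open>b\<close> shrinks the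
      distance to \<open>w\<close> by the factor \<open>L1 * t\<close>.\<close>
    have lip1_t: "norm (w - v\<^sub>0 (\<xi> - t *\<^sub>R b)) \<le> L1 * (t * norm (w - b))"
      if "\<xi> - t *\<^sub>R b \<in> cball \<xi> 1" for b
    proof -
      have "norm (w - v\<^sub>0 (\<xi> - t *\<^sub>R b)) \<le> L1 * norm (t *\<^sub>R (b - w))"
        using lip1[OF w_ball that] w by (simp add: algebra_simps)
      then show ?thesis using elim by (simp add: norm_minus_commute)
    qed
    have "norm w \<le> M" using M[OF w_ball] w by simp
    \<comment> \<open>The starting value \<open>b = 0\<close> has error
      \<open>norm w \<le> M\<close>, and its successor is the velocity at \<open>\<xi>\<close>
      itself.\<close>
    have "norm (w - v\<^sub>0 \<xi>) \<le> L1 * (t * norm w)"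
      using lip1_t[of 0] by simp
    also have "\<dots> \<le> L1 * (t * M)"
      using \<open>norm w \<le> M\<close> elim nonneg by (intro mult_left_mono) auto
    finally have w1: "norm (w - v\<^sub>0 \<xi>) \<le> L1 * (t * M)" .
    have "norm (w - v\<^sub>0 (\<xi> - t *\<^sub>R v\<^sub>0 \<xi>)) \<le> L1 * (t * norm (w - v\<^sub>0 \<xi>))"
      by (intro lip1_t in_ball) simp
    also have "\<dots> \<le> L1 * (t * (L1 * (t * M)))"
      using w1 elim nonneg by (intro mult_left_mono) auto
    finally have w2: "norm (w - v\<^sub>0 (\<xi> - t *\<^sub>R v\<^sub>0 \<xi>)) \<le> L1 * (t * (L1 * (t * M)))" .
    let ?b = "v\<^sub>0 (\<xi> - t *\<^sub>R v\<^sub>0 \<xi>)"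
    \<comment> \<open>The velocity error is of order \<open>t^2\<close>; multiplied by
      \<open>t\<close> in the argument of \<open>q0\<close> it yields the third power.\<close>
    have "norm (u t - q0 (\<xi> - t *\<^sub>R ?b)) = norm (q0 (\<xi> - t *\<^sub>R w) - q0 (\<xi> - t *\<^sub>R ?b))"
      using elim(1) by (simp add: w_def)
    also have "\<dots> \<le> L0 * norm ((\<xi> - t *\<^sub>R w) - (\<xi> - t *\<^sub>R ?b))"
      by (intro lip0 w_ball in_ball) simp
    also have "(\<xi> - t *\<^sub>R w) - (\<xi> - t *\<^sub>R ?b) = t *\<^sub>R (?b - w)"
      by (simp add: algebra_simps)
    also have "L0 * norm (t *\<^sub>R (?b - w)) = L0 * (t * norm (w - ?b))"
      using elim by (simp add: norm_minus_commute)
    also have "\<dots> \<le> L0 * (t * (L1 * (t * (L1 * (t * M)))))"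
      using w2 elim nonneg by (intro mult_left_mono) auto
    also have "\<dots> = L0 * L1\<^sup>2 * M * t ^ 3"
      by (simp add: power2_eq_square power3_eq_cube mult_ac)
    finally show ?case .
  qed
  with \<open>\<forall>\<^sub>F t in at_right 0. 0 < t\<close>
  have "\<forall>\<^sub>F t in at_right 0.
          norm (norm (u t - q0 (\<xi> - t *\<^sub>R v\<^sub>0 (\<xi> - t *\<^sub>R v\<^sub>0 \<xi>)))) \<le> L0 * L1\<^sup>2 * M * norm (t ^ 3)"
    by eventually_elim simp
  then show ?thesis
    unfolding v\<^sub>0_def by (rule bigoI)
qed

section \<open>From the coordinate form of the system to the expansion\<close>

theorem theorem3p2:
  fixes T :: real
    and q :: "real \<Rightarrow> real \<times> real \<Rightarrow> real ^ 'm"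
    and q0 :: "real \<times> real \<Rightarrow> real ^ 'm"
    and Jx Jy :: "real ^ 'm \<Rightarrow> real ^ 'm ^ 'm"
    and vx vy :: "real ^ 'm \<Rightarrow> real"
    and v0 :: "real \<times> real \<Rightarrow> real \<times> real"
  assumes T_pos: "0 < T"
    and system: "\<And>t x y. t \<in> {0..<T} \<Longrightarrow>
          vector_derivative (\<lambda>s. q s (x, y)) (at t within {0..<T})
          + Jx (q t (x, y)) *v vector_derivative (\<lambda>s. q t (s, y)) (at x)
          + Jy (q t (x, y)) *v vector_derivative (\<lambda>s. q t (x, s)) (at y) = 0"
    and initial: "\<And>\<xi>. q 0 \<xi> = q0 \<xi>"
    and Jx: "\<And>p. Jx p = vx p *\<^sub>R mat 1"
    and Jy: "\<And>p. Jy p = vy p *\<^sub>R mat 1"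
    and vx_smooth: "smooth_on UNIV vx"
    and vy_smooth: "smooth_on UNIV vy"
    and q_smooth: "smooth_on ({0..<T} \<times> UNIV) (\<lambda>(t, \<xi>). q t \<xi>)"
    and v0: "v0 = initial_velocity vx vy q0"
  shows "\<forall>\<xi>. (\<lambda>t. norm (q t \<xi> - q0 (\<xi> - t *\<^sub>R v0 (\<xi> - t *\<^sub>R v0 \<xi>))))
              \<in> O[at_right 0](\<lambda>t. t ^ 3)"
proof
  fix \<xi> :: "real \<times> real"
  let ?S = "{0..<T} \<times> (UNIV :: (real \<times> real) set)"
  define F where "F = (\<lambda>(t, \<xi>). q t \<xi>)"
  define v where "v = (\<lambda>p. (vx p, vy p))"
  have "Ck_on (Suc 0) ?S F"
    using q_smooth unfolding smooth_on_def F_def by blast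
  then obtain D where D: "\<And>z. z \<in> ?S \<Longrightarrow> (F has_derivative D z) (at z within ?S)"
    and contD: "\<And>u. continuous_on ?S (\<lambda>z. D z u)"
    by auto
  have lip_smooth: "\<exists>L. L-lipschitz_on (cball 0 r) g"
    if g: "smooth_on UNIV g" for r and g :: "real ^ 'm \<Rightarrow> real"
  proof -
    have "Ck_on (Suc 0) UNIV g" using g unfolding smooth_on_def by blast
    then obtain G where "\<And>x. (g has_derivative G x) (at x)"
      and "\<And>u. continuous_on UNIV (\<lambda>x. G x u)" by auto
    then obtain L where "L-lipschitz_on (cball 0 r) g"
      using C1_imp_lipschitz_on_compact_convex[of "cball 0 r" UNIV g G] by auto
    then show ?thesis ..
  qed
  have lip_v: "\<exists>L. L-lipschitz_on (cball 0 r) v" for r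
    using lip_smooth[OF vx_smooth, of r] lip_smooth[OF vy_smooth, of r]
    unfolding v_def by (blast intro: lipschitz_on_Pair)
  \<comment> \<open>The partial derivatives are the values of \<open>D z\<close> on the coordinate
    vectors. Since the matrices are scalar multiples of the identity, linearity collects the system
    into one directional derivative along \<open>(1, v (F z))\<close>.\<close>
  have transport: "D z (1, v (F z)) = 0" if z: "z \<in> ?S" for z
  proof -
    obtain t x y where z_eq: "z = (t, x, y)" by (metis prod.exhaust)
    have t: "t \<in> {0..<T}" using z by (simp add: z_eq)
    have chain: "(F \<circ> h has_vector_derivative D z h') (at s within A)"
      if "(h has_vector_derivative h') (at s within A)" "h s = z" "\<And>r. r \<in> A \<Longrightarrow> h r \<in> ?S" for h h' s A
    proof -
      have "h ` A \<subseteq> ?S" using that(3) by blast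
      then show ?thesis
        using vector_derivative_diff_chain_within[OF that(1)] D[OF z] that(2)
          has_derivative_subset by blast
    qed
    have "((\<lambda>s. q s (x, y)) has_vector_derivative D z (1, 0, 0)) (at t within {0..<T})"
    proof -
      have "((\<lambda>s. (s, x, y)) has_vector_derivative (1, 0, 0)) (at t within {0..<T})"
        by (intro has_vector_derivative_Pair has_vector_derivative_id has_vector_derivative_const)
      from chain[OF this] show ?thesis
        using t by (auto simp: F_def o_def z_eq)
    qed
    \<comment> \<open>\<open>vector_derivative\<close> within a set is determined only at limit
      points; this includes the one-sided case \<open>t = 0\<close>.\<close>
    moreover have "at t within {0..<T} \<noteq> bot"
      using t by (simp add: trivial_limit_within islimpt_Ico)
    ultimately have dt: "vector_derivative (\<lambda>s. q s (x, y)) (at t within {0..<T}) = D z (1, 0, 0)"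
      by (intro vector_derivative_within)
    have "((\<lambda>s. q t (s, y)) has_vector_derivative D z (0, 1, 0)) (at x)"
    proof -
      have "((\<lambda>s. (t, s, y)) has_vector_derivative (0, 1, 0)) (at x within UNIV)"
        by (intro has_vector_derivative_Pair has_vector_derivative_id has_vector_derivative_const)
      from chain[OF this] show ?thesis
        using t by (auto simp: F_def o_def z_eq)
    qed
    then have dx: "vector_derivative (\<lambda>s. q t (s, y)) (at x) = D z (0, 1, 0)"
      by (rule vector_derivative_at)
    have "((\<lambda>s. q t (x, s)) has_vector_derivative D z (0, 0, 1)) (at y)"
    proof -
      have "((\<lambda>s. (t, x, s)) has_vector_derivative (0, 0, 1)) (at y within UNIV)"
        by (intro has_vector_derivative_Pair has_vector_derivative_id has_vector_derivative_const)
      from chain[OF this] show ?thesis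
        using t by (auto simp: F_def o_def z_eq)
    qed
    then have dy: "vector_derivative (\<lambda>s. q t (x, s)) (at y) = D z (0, 0, 1)"
      by (rule vector_derivative_at)
    have lin: "linear (D z)" using D[OF z] by (rule has_derivative_linear)
    have "(1 :: real, v (F z)) = (1, 0, 0) + vx (F z) *\<^sub>R (0, 1, 0) + vy (F z) *\<^sub>R (0, 0, 1)"
      by (simp add: v_def zero_prod_def)
    then have "D z (1, v (F z)) =
        D z (1, 0, 0) + vx (F z) *\<^sub>R D z (0, 1, 0) + vy (F z) *\<^sub>R D z (0, 0, 1)"
      by (simp only: linear_add[OF lin] linear_scale[OF lin])
    also have "\<dots> = 0"
      using system[OF t, of x y] unfolding dt dx dy
      by (simp add: Jx Jy F_def z_eq scaleR_matrix_vector_assoc[symmetric])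
    finally show ?thesis .
  qed
  have F0: "F (0, x) = q0 x" for x by (simp add: F_def initial)
  have contF: "continuous_on ?S F"
    by (rule has_derivative_continuous_on[OF D])
  \<comment> \<open>The Lipschitz bound for \<open>q0\<close> is read off from \<open>F\<close> on
    the initial time slice.\<close>
  obtain L where lip_F: "L-lipschitz_on ({0} \<times> cball \<xi> 1) F"
  proof (rule C1_imp_lipschitz_on_compact_convex[OF _ _ _ D contD])
    show "compact ({0 :: real} \<times> cball \<xi> 1)" "convex ({0 :: real} \<times> cball \<xi> 1)"
      by (intro compact_Times convex_Times; simp)+
  qed (use T_pos in auto)
  have lip_q0: "L-lipschitz_on (cball \<xi> 1) q0"
  proof (rule lipschitz_onI)
    show "dist (q0 x) (q0 y) \<le> L * dist x y" if "x \<in> cball \<xi> 1" "y \<in> cball \<xi> 1" for x y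
      using lipschitz_onD[OF lip_F, of "(0, x)" "(0, y)"] that by (simp add: F0 dist_Pair_Pair)
  qed (rule lipschitz_on_nonneg[OF lip_F])
  then have "bounded (q0 ` cball \<xi> 1)"
    by (intro compact_imp_bounded compact_continuous_image lipschitz_on_continuous_on) auto
  \<comment> \<open>The ball must contain the values of \<open>q0\<close> near \<open>\<xi>\<close>,
    so that the Lipschitz bounds of \<open>v\<close> and \<open>q0\<close> compose.\<close>
  then obtain R where R: "q0 ` cball \<xi> 1 \<subseteq> cball 0 R"
    using bounded_subset_ballD[of _ 0] ball_subset_cball by (meson subset_trans)
  obtain L' where "L'-lipschitz_on (cball 0 R) v" using lip_v by blast
  then have lip_v0: "(L' * L)-lipschitz_on (cball \<xi> 1) (\<lambda>x. v (q0 x))"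
    using lip_q0 R by (intro lipschitz_on_compose2) (auto intro: lipschitz_on_subset)
  have "continuous_on UNIV v"
    using vx_smooth vy_smooth unfolding v_def smooth_on_def
    by (intro continuous_on_Pair) (metis Ck_on.simps(1))+
  then have "continuous_on {0..T / 2} (\<lambda>t. v (F (t, \<xi>)))"
    by (rule continuous_on_compose2)
      (use T_pos in \<open>auto intro!: continuous_on_compose2[OF contF] continuous_intros\<close>)
  \<comment> \<open>Continuity at the left end point of the interval is exactly the limit from the
    right.\<close>
  then have "((\<lambda>t. v (F (t, \<xi>))) \<longlongrightarrow> v (F (0, \<xi>))) (at 0 within {0..T / 2})"
    using T_pos by (simp add: continuous_on_def)
  then have "((\<lambda>t. v (F (t, \<xi>))) \<longlongrightarrow> v (F (0, \<xi>))) (at_right 0)"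
    using T_pos by (simp add: at_within_Icc_at_right)
  moreover have "\<forall>\<^sub>F t in at_right 0. F (t, \<xi>) = q0 (\<xi> - t *\<^sub>R v (F (t, \<xi>)))"
    using transport_implicit_solution[OF T_pos D contD transport lip_v, of \<xi>] by (simp add: F0)
  ultimately have "(\<lambda>t. norm (F (t, \<xi>) - q0 (\<xi> - t *\<^sub>R v (q0 (\<xi> - t *\<^sub>R v (q0 \<xi>))))))
      \<in> O[at_right 0](\<lambda>t. t ^ 3)"
    using lip_q0 lip_v0 by (intro implicit_solution_expansion)
  moreover have "v0 = (\<lambda>x. v (q0 x))"
    by (simp add: v0 initial_velocity_def v_def fun_eq_iff)
  ultimately show "(\<lambda>t. norm (q t \<xi> - q0 (\<xi> - t *\<^sub>R v0 (\<xi> - t *\<^sub>R v0 \<xi>))))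
      \<in> O[at_right 0](\<lambda>t. t ^ 3)"
    by (simp add: F_def)
qed

end
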